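(* Every maximal ideal $M\subset \mathcal{R}_{\mathbb{R}}$ falls into exactly one of the following types: (i) $z\in M$; (ii) $n\in M$ for some integer $n$ with $|n|>1$, but $z\notin M$; (iii) neither $z$ nor any nonzero integer constant belongs to $M$. Moreover, type (ii) cannot occur: no maximal ideal of $\mathcal{R}_{\mathbb{R}}$ contains an integer $n$ with $|n|>1$ but not $z$.
   Context: $\mathbb{D}=\{z\in\mathbb{C}:|z|<1\}$ is the open unit disk and $\mathcal{O}(\mathbb{D})$ is the ring of holomorphic functions on $\mathbb{D}$. $\mathcal{R}_{\mathbb{R}}=\mathbb{Z}[[z]]\cap\mathcal{O}(\mathbb{D})$ is the ring of holomorphic functions on $\mathbb{D}$ all of whose Taylor coefficients at $0$ are integers; integers are regarded as constant series in $\mathcal{R}_{\mathbb{R}}$, and $z$ is the coordinate function. *)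

theory Defs
  imports "HOL-Complex_Analysis.Complex_Analysis" "HOL-Algebra.Algebra"
begin

abbreviation unit_disk :: "complex set" where
  "unit_disk \<equiv> ball 0 1"

text \<open>A function on the unit disk is represented by its extensional HOL function, so that two
  elements of the ring are equal iff they agree on the disk.\<close>

definition RR :: "(complex \<Rightarrow> complex) ring" where
  "RR = \<lparr>carrier = {f \<in> extensional unit_disk. f holomorphic_on unit_disk \<and>
                       (\<forall>n. (deriv ^^ n) f 0 / fact n \<in> \<int>)},
         monoid.mult = (\<lambda>f g. \<lambda>z\<in>unit_disk. f z * g z),
         monoid.one = (\<lambda>z\<in>unit_disk. 1),
         ring.zero = (\<lambda>z\<in>unit_disk. 0),
         ring.add = (\<lambda>f g. \<lambda>z\<in>unit_disk. f z + g z)\<rparr>"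

definition RR_const :: "int \<Rightarrow> complex \<Rightarrow> complex" where
  "RR_const n = (\<lambda>z\<in>unit_disk. of_int n)"

definition RR_z :: "complex \<Rightarrow> complex" where
  "RR_z = (\<lambda>z\<in>unit_disk. z)"

lemma RR_iff:
  "f \<in> carrier RR \<longleftrightarrow> f \<in> extensional unit_disk \<and> f holomorphic_on unit_disk \<and>
     (\<forall>n. (deriv ^^ n) f 0 / fact n \<in> \<int>)"
  by (simp add: RR_def)

lemma RR_coeff: "f \<in> carrier RR \<Longrightarrow> (deriv ^^ n) f 0 / fact n \<in> \<int>"
  by (simp add: RR_iff)

lemma RR_apply:
  assumes "z \<in> unit_disk"
  shows "(f \<oplus>\<^bsub>RR\<^esub> g) z = f z + g z" "(f \<otimes>\<^bsub>RR\<^esub> g) z = f z * g z"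
    "\<zero>\<^bsub>RR\<^esub> z = 0" "\<one>\<^bsub>RR\<^esub> z = 1"
    "RR_const n z = of_int n" "RR_z z = z"
  using assms by (simp_all add: RR_def RR_const_def RR_z_def)

lemma restrict_deriv:
  "(deriv ^^ n) (restrict f unit_disk) 0 = (deriv ^^ n) f (0::complex)"
  by (rule higher_deriv_cong_ev) (auto simp: eventually_nhds intro!: exI[of _ unit_disk])

lemma restrict_RR:
  assumes "f holomorphic_on unit_disk" "\<And>n. (deriv ^^ n) f 0 / fact n \<in> \<int>"
  shows "restrict f unit_disk \<in> carrier RR"
proof -
  have "restrict f unit_disk holomorphic_on unit_disk"
    by (rule holomorphic_transform[OF assms(1)]) auto
  then show ?thesis
    using assms(2) by (simp only: RR_iff restrict_deriv) auto
qed

lemma RR_add: "f \<in> carrier RR \<Longrightarrow> g \<in> carrier RR \<Longrightarrow> f \<oplus>\<^bsub>RR\<^esub> g \<in> carrier RR"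
proof -
  assume f: "f \<in> carrier RR" and g: "g \<in> carrier RR"
  have "(\<lambda>z\<in>unit_disk. f z + g z) \<in> carrier RR"
  proof (rule restrict_RR)
    show "(\<lambda>z. f z + g z) holomorphic_on unit_disk"
      using f g by (auto simp: RR_iff intro!: holomorphic_intros)
    show "(deriv ^^ n) (\<lambda>z. f z + g z) 0 / fact n \<in> \<int>" for n
      using f g
      by (subst higher_deriv_add[where S=unit_disk])
         (auto simp: RR_iff add_divide_distrib intro!: Ints_add)
  qed
  then show ?thesis by (simp add: RR_def)
qed

lemma RR_mult: "f \<in> carrier RR \<Longrightarrow> g \<in> carrier RR \<Longrightarrow> f \<otimes>\<^bsub>RR\<^esub> g \<in> carrier RR"
proof -
  assume f: "f \<in> carrier RR" and g: "g \<in> carrier RR"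
  have "(\<lambda>z\<in>unit_disk. f z * g z) \<in> carrier RR"
  proof (rule restrict_RR)
    show "(\<lambda>z. f z * g z) holomorphic_on unit_disk"
      using f g by (auto simp: RR_iff intro!: holomorphic_intros)
    show "(deriv ^^ n) (\<lambda>z. f z * g z) 0 / fact n \<in> \<int>" for n
    proof -
      have "(deriv ^^ n) (\<lambda>z. f z * g z) 0 =
          (\<Sum>i=0..n. of_nat (n choose i) * (deriv ^^ i) f 0 * (deriv ^^ (n - i)) g 0)"
        using f g by (intro higher_deriv_mult[where S=unit_disk]) (auto simp: RR_iff)
      then have "(deriv ^^ n) (\<lambda>z. f z * g z) 0 / fact n =
          (\<Sum>i=0..n. of_nat (n choose i) * (deriv ^^ i) f 0 * (deriv ^^ (n - i)) g 0 / fact n)"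
        by (simp only: sum_divide_distrib)
      also have "\<dots> =
          (\<Sum>i=0..n. ((deriv ^^ i) f 0 / fact i) * ((deriv ^^ (n - i)) g 0 / fact (n - i)))"
        by (rule sum.cong) (auto simp: binomial_fact field_simps)
      also have "\<dots> \<in> \<int>"
        by (intro Ints_sum Ints_mult RR_coeff f g)
      finally show ?thesis .
    qed
  qed
  then show ?thesis by (simp add: RR_def)
qed

lemma RR_const_closed: "RR_const n \<in> carrier RR"
  unfolding RR_const_def by (rule restrict_RR) (auto simp: higher_deriv_const)

lemma RR_z_closed: "RR_z \<in> carrier RR"
  unfolding RR_z_def
proof (rule restrict_RR)
  show "(deriv ^^ n) (\<lambda>z. z) (0::complex) / fact n \<in> \<int>" for n
    by (cases "n = 1") (auto simp: higher_deriv_ident)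
qed auto

lemma cring_RR: "cring RR"
proof (rule cringI)
  have zero: "\<zero>\<^bsub>RR\<^esub> \<in> carrier RR" and one: "\<one>\<^bsub>RR\<^esub> \<in> carrier RR"
    using RR_const_closed[of 0] RR_const_closed[of 1] by (simp_all add: RR_def RR_const_def)
  have ext: "f = g" if "f \<in> carrier RR" "g \<in> carrier RR" "\<And>z. z \<in> unit_disk \<Longrightarrow> f z = g z" for f g
    using that by (intro extensionalityI[of f unit_disk g]) (auto simp: RR_iff)
  have neg: "\<exists>g\<in>carrier RR. g \<oplus>\<^bsub>RR\<^esub> f = \<zero>\<^bsub>RR\<^esub>" if "f \<in> carrier RR" for f
  proof
    show "RR_const (-1) \<otimes>\<^bsub>RR\<^esub> f \<in> carrier RR" by (intro RR_mult RR_const_closed that)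
    then show "RR_const (-1) \<otimes>\<^bsub>RR\<^esub> f \<oplus>\<^bsub>RR\<^esub> f = \<zero>\<^bsub>RR\<^esub>"
      by (intro ext RR_add zero that) (simp_all add: RR_apply)
  qed
  show "abelian_group RR"
  proof (rule abelian_groupI)
    show "\<And>x y z. \<lbrakk>x \<in> carrier RR; y \<in> carrier RR; z \<in> carrier RR\<rbrakk> \<Longrightarrow>
      x \<oplus>\<^bsub>RR\<^esub> y \<oplus>\<^bsub>RR\<^esub> z = x \<oplus>\<^bsub>RR\<^esub> (y \<oplus>\<^bsub>RR\<^esub> z)"
      by (intro ext RR_add) (simp_all add: RR_apply)
    show "\<And>x y. \<lbrakk>x \<in> carrier RR; y \<in> carrier RR\<rbrakk> \<Longrightarrow> x \<oplus>\<^bsub>RR\<^esub> y = y \<oplus>\<^bsub>RR\<^esub> x"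
      by (intro ext RR_add) (simp_all add: RR_apply)
    show "\<And>x. x \<in> carrier RR \<Longrightarrow> \<zero>\<^bsub>RR\<^esub> \<oplus>\<^bsub>RR\<^esub> x = x"
      by (intro ext RR_add zero) (simp_all add: RR_apply)
  qed (use zero neg RR_add in auto)
  show "Group.comm_monoid RR"
  proof (rule comm_monoidI)
    show "\<And>x y z. \<lbrakk>x \<in> carrier RR; y \<in> carrier RR; z \<in> carrier RR\<rbrakk> \<Longrightarrow>
      x \<otimes>\<^bsub>RR\<^esub> y \<otimes>\<^bsub>RR\<^esub> z = x \<otimes>\<^bsub>RR\<^esub> (y \<otimes>\<^bsub>RR\<^esub> z)"
      by (intro ext RR_mult) (simp_all add: RR_apply)
    show "\<And>x y. \<lbrakk>x \<in> carrier RR; y \<in> carrier RR\<rbrakk> \<Longrightarrow> x \<otimes>\<^bsub>RR\<^esub> y = y \<otimes>\<^bsub>RR\<^esub> x"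
      by (intro ext RR_mult) (simp_all add: RR_apply)
    show "\<And>x. x \<in> carrier RR \<Longrightarrow> \<one>\<^bsub>RR\<^esub> \<otimes>\<^bsub>RR\<^esub> x = x"
      by (intro ext RR_mult one) (simp_all add: RR_apply)
  qed (use one RR_mult in auto)
  show "\<And>x y z. \<lbrakk>x \<in> carrier RR; y \<in> carrier RR; z \<in> carrier RR\<rbrakk> \<Longrightarrow>
      (x \<oplus>\<^bsub>RR\<^esub> y) \<otimes>\<^bsub>RR\<^esub> z = x \<otimes>\<^bsub>RR\<^esub> z \<oplus>\<^bsub>RR\<^esub> y \<otimes>\<^bsub>RR\<^esub> z"
    by (intro ext RR_mult RR_add) (simp_all add: RR_apply algebra_simps)
qed

definition type_i :: "(complex \<Rightarrow> complex) set \<Rightarrow> bool" where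
  "type_i M \<longleftrightarrow> RR_z \<in> M"

definition type_ii :: "(complex \<Rightarrow> complex) set \<Rightarrow> bool" where
  "type_ii M \<longleftrightarrow> (\<exists>n::int. \<bar>n\<bar> > 1 \<and> RR_const n \<in> M) \<and> RR_z \<notin> M"

definition type_iii :: "(complex \<Rightarrow> complex) set \<Rightarrow> bool" where
  "type_iii M \<longleftrightarrow> RR_z \<notin> M \<and> (\<forall>n::int. n \<noteq> 0 \<longrightarrow> RR_const n \<notin> M)"

end

theory Submission
  imports Defs
begin

text \<open>
  The three types exclude each other by definition. Everything else follows from one fact: a
  maximal ideal that contains a nonzero integer contains \<open>z\<close> (\<open>maximal_ideal_int_imp_z\<close>). It makes
  type (ii) empty, and it puts every maximal ideal that avoids \<open>z\<close> into type (iii).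

  If \<open>M\<close> is maximal and does not contain \<open>z\<close>, then \<open>M\<close> and \<open>z\<close> generate the unit ideal, so \<open>M\<close>
  contains a function \<open>m = 1 - z f\<close>, whose value at \<open>0\<close> is \<open>1\<close>. The Taylor series of \<open>m\<close> is
  invertible in \<open>\<int>[[z]]\<close>. Its inverse \<open>G\<close> need not converge on the disk, but modulo a nonzero
  integer \<open>n\<close> this does not matter: replacing every coefficient of \<open>G\<close> by its residue modulo \<open>n\<close>
  gives bounded coefficients, hence a function \<open>g\<close> that is holomorphic on the whole disk
  (\<open>bounded_int_series_on_disk\<close>). In other words, \<open>RR / (n)\<close> is the full power series ring over
  \<open>\<int>/n\<close>, in which constant term \<open>1\<close> implies invertibility. Then \<open>k = (1 - m g) / n\<close> is holomorphic
  with integer coefficients and \<open>m g + n k = 1\<close> (\<open>unit_modulo_int\<close>), so that \<open>M\<close> cannot contain \<open>n\<close>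
  as well.
\<close>

definition of_int_fps :: "int fps \<Rightarrow> complex fps" where
  "of_int_fps F = Abs_fps (\<lambda>j. of_int (fps_nth F j))"

lemma of_int_fps_nth [simp]: "fps_nth (of_int_fps F) j = of_int (fps_nth F j)"
  by (simp add: of_int_fps_def)

lemma of_int_fps_mult: "of_int_fps (F * G) = of_int_fps F * of_int_fps G"
  by (rule fps_ext) (simp add: fps_mult_nth)

lemma of_int_fps_diff: "of_int_fps (F - G) = of_int_fps F - of_int_fps G"
  by (rule fps_ext) simp

lemma of_int_fps_1 [simp]: "of_int_fps 1 = 1"
  by (rule fps_ext) simp

lemma of_int_fps_const: "of_int_fps (fps_const n) = fps_const (of_int n)"
  by (rule fps_ext) simp

lemma RR_has_int_expansion:
  assumes "f \<in> carrier RR"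
  obtains F where "f has_fps_expansion of_int_fps F"
proof -
  have "\<forall>j. \<exists>c::int. (deriv ^^ j) f 0 / fact j = of_int c"
    using RR_coeff[OF assms] by (auto elim: Ints_cases)
  then obtain c :: "nat \<Rightarrow> int" where c: "\<And>j. (deriv ^^ j) f 0 / fact j = of_int (c j)"
    by metis
  have "f has_fps_expansion fps_expansion f 0"
    using assms by (intro has_fps_expansion_fps_expansion[of unit_disk]) (auto simp: RR_iff)
  moreover have "fps_expansion f 0 = of_int_fps (Abs_fps c)"
    by (rule fps_ext) (simp add: fps_expansion_def c)
  ultimately show thesis using that by metis
qed

lemma RR_of_int_expansion:
  assumes "f holomorphic_on unit_disk" "f has_fps_expansion of_int_fps F"
  shows "restrict f unit_disk \<in> carrier RR"
  using assms(1)
proof (rule restrict_RR)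
  show "(deriv ^^ j) f 0 / fact j \<in> \<int>" for j
    using fps_nth_fps_expansion[OF assms(2), of j] by (metis Ints_of_int of_int_fps_nth)
qed

lemma RR_eqI:
  assumes "f \<in> carrier RR" "g \<in> carrier RR" "\<And>z. z \<in> unit_disk \<Longrightarrow> f z = g z"
  shows "f = g"
  using assms by (intro extensionalityI[of f unit_disk g]) (auto simp: RR_iff)

text \<open>By comparison with the geometric series, whose disk of convergence is exactly the unit disk.\<close>

lemma bounded_int_series_on_disk:
  assumes "\<And>j. \<bar>fps_nth A j\<bar> \<le> K"
  shows "eval_fps (of_int_fps A) holomorphic_on unit_disk"
    and "eval_fps (of_int_fps A) has_fps_expansion of_int_fps A"
proof -
  have radius: "fps_conv_radius (of_int_fps A) \<ge> 1"
    unfolding fps_conv_radius_def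
  proof (rule conv_radius_geI_ex')
    fix r :: real assume r: "0 < r" "ereal r < 1"
    have le: "norm (fps_nth (of_int_fps A) j * of_real r ^ j) \<le> of_int K * r ^ j" for j
      using assms[of j] r(1) by (simp add: norm_mult norm_power flip: of_int_abs)
    have "summable (\<lambda>j. of_int K * r ^ j)"
      using r by (intro summable_mult[OF summable_geometric]) simp
    then show "summable (\<lambda>j. fps_nth (of_int_fps A) j * of_real r ^ j)"
      by (rule summable_comparison_test') (rule le)
  qed
  show "eval_fps (of_int_fps A) holomorphic_on unit_disk"
    using radius by (intro holomorphic_on_eval_fps ball_eball_mono) (simp add: one_ereal_def)
  have "fps_conv_radius (of_int_fps A) > 0"
    using radius by (rule less_le_trans[rotated]) simp
  then show "eval_fps (of_int_fps A) has_fps_expansion of_int_fps A"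
    by (rule eval_fps_has_fps_expansion)
qed

text \<open>The formal inverse \<open>G\<close> of the Taylor series of \<open>m\<close> is split as \<open>G = A + n B\<close> with the
  coefficients of \<open>A\<close> in a complete residue system. Only \<open>A\<close> has to converge on the disk, since
  \<open>(1 - m g) / n\<close> is holomorphic there as soon as \<open>g\<close> is, and its coefficients are those of
  \<open>m B\<close>.\<close>

lemma unit_modulo_int:
  assumes m: "m \<in> carrier RR" and m0: "m 0 = 1" and n: "n \<noteq> 0"
  obtains g k where "g \<in> carrier RR" "k \<in> carrier RR"
    "m \<otimes>\<^bsub>RR\<^esub> g \<oplus>\<^bsub>RR\<^esub> RR_const n \<otimes>\<^bsub>RR\<^esub> k = \<one>\<^bsub>RR\<^esub>"
proof -
  obtain F where F: "m has_fps_expansion of_int_fps F"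
    using RR_has_int_expansion[OF m] .
  have "fps_nth F 0 = 1"
    using fps_nth_fps_expansion[OF F, of 0] m0 by simp
  define G where "G = fps_right_inverse F 1"
  have FG: "F * G = 1"
    unfolding G_def by (rule fps_right_inverse) (simp add: \<open>fps_nth F 0 = 1\<close>)
  define A where "A = Abs_fps (\<lambda>j. fps_nth G j mod n)"
  define B where "B = Abs_fps (\<lambda>j. fps_nth G j div n)"
  have "G = A + fps_const n * B"
    by (rule fps_ext) (simp add: A_def B_def)
  then have FA: "1 - F * A = fps_const n * (F * B)"
    using FG by (simp add: algebra_simps)
  have "\<bar>fps_nth A j\<bar> \<le> \<bar>n\<bar>" for j
    unfolding A_def using abs_mod_less[OF n, of "fps_nth G j"] by simp
  note A = bounded_int_series_on_disk[OF this]
  define g where "g = eval_fps (of_int_fps A)"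
  define k where "k = (\<lambda>z. inverse (of_int n) * (1 - m z * g z))"
  have g: "restrict g unit_disk \<in> carrier RR"
    unfolding g_def using A by (rule RR_of_int_expansion)
  have k: "restrict k unit_disk \<in> carrier RR"
  proof (rule RR_of_int_expansion)
    show "k holomorphic_on unit_disk"
      using m A(1) by (auto simp: k_def g_def RR_iff intro!: holomorphic_intros)
    have "k has_fps_expansion fps_const (inverse (of_int n)) * (1 - of_int_fps F * of_int_fps A)"
      unfolding k_def g_def by (intro fps_expansion_intros F A(2))
    also have "1 - of_int_fps F * of_int_fps A = fps_const (of_int n) * of_int_fps (F * B)"
      using arg_cong[OF FA, of of_int_fps]
      by (simp add: of_int_fps_mult of_int_fps_diff of_int_fps_const)
    also have "fps_const (inverse (of_int n)) * \<dots> = of_int_fps (F * B)"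
      using n by (simp flip: mult.assoc)
    finally show "k has_fps_expansion of_int_fps (F * B)" .
  qed
  have "m \<otimes>\<^bsub>RR\<^esub> restrict g unit_disk \<oplus>\<^bsub>RR\<^esub> RR_const n \<otimes>\<^bsub>RR\<^esub> restrict k unit_disk = \<one>\<^bsub>RR\<^esub>"
  proof (rule RR_eqI)
    show "\<one>\<^bsub>RR\<^esub> \<in> carrier RR"
      using cring_RR by (simp add: cring_def ring.ring_simprules(6))
    show "m \<otimes>\<^bsub>RR\<^esub> restrict g unit_disk \<oplus>\<^bsub>RR\<^esub> RR_const n \<otimes>\<^bsub>RR\<^esub> restrict k unit_disk \<in> carrier RR"
      by (intro RR_add RR_mult RR_const_closed m g k)
  qed (use n in \<open>simp add: RR_apply k_def field_simps\<close>)
  then show thesis by (rule that[OF g k])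
qed

text \<open>By maximality, \<open>M + (z)\<close> is the whole ring; in \<open>1 = m + z f\<close>, the second summand vanishes
  at \<open>0\<close>.\<close>

lemma maximal_ideal_without_z:
  assumes "maximalideal M RR" "RR_z \<notin> M"
  obtains m where "m \<in> M" "m 0 = 1"
proof -
  interpret cring RR by (rule cring_RR)
  interpret maximalideal M RR by fact
  let ?J = "M <+>\<^bsub>RR\<^esub> (PIdl\<^bsub>RR\<^esub> RR_z)"
  have P: "ideal (PIdl\<^bsub>RR\<^esub> RR_z) RR" "RR_z \<in> PIdl\<^bsub>RR\<^esub> RR_z"
    by (simp_all add: cgenideal_ideal cgenideal_self RR_z_closed)
  have J: "ideal ?J RR"
    by (intro add_ideals is_ideal P)
  have sub: "M \<subseteq> ?J"
  proof
    fix x assume "x \<in> M"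
    moreover have "x = x \<oplus>\<^bsub>RR\<^esub> \<zero>\<^bsub>RR\<^esub>" using a_subset \<open>x \<in> M\<close> by auto
    moreover have "\<zero>\<^bsub>RR\<^esub> \<in> PIdl\<^bsub>RR\<^esub> RR_z"
      using P(1) by (simp add: additive_subgroup.zero_closed ideal.axioms(1))
    ultimately show "x \<in> ?J" unfolding set_add_def' by blast
  qed
  have "RR_z = \<zero>\<^bsub>RR\<^esub> \<oplus>\<^bsub>RR\<^esub> RR_z"
    by (simp add: RR_z_closed)
  then have "RR_z \<in> ?J"
    using P(2) zero_closed unfolding set_add_def' by blast
  then have "?J = carrier RR"
    using I_maximal[OF J sub] ideal.Icarr[OF J] assms(2) by blast
  then have "\<one>\<^bsub>RR\<^esub> \<in> ?J" by simp
  then obtain m f where mf: "m \<in> M" "\<one>\<^bsub>RR\<^esub> = m \<oplus>\<^bsub>RR\<^esub> f \<otimes>\<^bsub>RR\<^esub> RR_z"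
    unfolding set_add_def' cgenideal_def by blast
  have "m 0 = 1"
    using fun_cong[OF mf(2), of 0] by (simp add: RR_apply)
  with mf(1) show thesis using that by blast
qed

lemma maximal_ideal_int_imp_z:
  assumes M: "maximalideal M RR" and n: "RR_const n \<in> M" "n \<noteq> 0"
  shows "RR_z \<in> M"
proof (rule ccontr)
  interpret maximalideal M RR by fact
  assume "RR_z \<notin> M"
  then obtain m where m: "m \<in> M" "m 0 = 1"
    using maximal_ideal_without_z[OF M] by blast
  obtain g k where "g \<in> carrier RR" "k \<in> carrier RR"
    "m \<otimes>\<^bsub>RR\<^esub> g \<oplus>\<^bsub>RR\<^esub> RR_const n \<otimes>\<^bsub>RR\<^esub> k = \<one>\<^bsub>RR\<^esub>"
    using unit_modulo_int[OF Icarr[OF m(1)] m(2) n(2)] .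
  moreover from this have "m \<otimes>\<^bsub>RR\<^esub> g \<oplus>\<^bsub>RR\<^esub> RR_const n \<otimes>\<^bsub>RR\<^esub> k \<in> M"
    using m(1) n(1) by (intro additive_subgroup.a_closed[OF is_additive_subgroup] I_r_closed)
  ultimately have "\<one>\<^bsub>RR\<^esub> \<in> M" by simp
  then show False
    using one_imp_carrier I_notcarr by blast
qed

theorem proposition3p1:
  shows "(\<forall>M. maximalideal M RR \<longrightarrow>
            (type_i M \<or> type_ii M \<or> type_iii M) \<and>
            \<not> (type_i M \<and> type_ii M) \<and> \<not> (type_i M \<and> type_iii M) \<and> \<not> (type_ii M \<and> type_iii M))
       \<and> \<not> (\<exists>M n. maximalideal M RR \<and> \<bar>n::int\<bar> > 1 \<and> RR_const n \<in> M \<and> RR_z \<notin> M)"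
proof -
  have not_ii: "\<not> type_ii M" if M: "maximalideal M RR" for M
  proof
    assume "type_ii M"
    then obtain n :: int where n: "\<bar>n\<bar> > 1" "RR_const n \<in> M" "RR_z \<notin> M"
      unfolding type_ii_def by (elim conjE exE)
    from n(1) have "n \<noteq> 0" by auto
    with n(3) show False using maximal_ideal_int_imp_z[OF M n(2)] by simp
  qed
  have i_or_iii: "type_i M \<or> type_iii M" if "maximalideal M RR" for M
    using maximal_ideal_int_imp_z[OF that] unfolding type_i_def type_iii_def by metis
  have not_both: "\<not> (type_i M \<and> type_iii M)" for M
    by (simp add: type_i_def type_iii_def)
  show ?thesis
  proof (intro conjI allI impI)
    show "\<not> (\<exists>M n. maximalideal M RR \<and> \<bar>n::int\<bar> > 1 \<and> RR_const n \<in> M \<and> RR_z \<notin> M)"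
      using not_ii unfolding type_ii_def by metis
  qed (use not_ii i_or_iii not_both in simp_all)
qed

end
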